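(* Let $(x,y)$ be drawn from the mixed linear regression model in $\mathbb{R}^d$ with component vectors $\mu_1,\dots,\mu_k$, mixture weights $\alpha_1,\dots,\alpha_k$ and noise variance $\sigma^2$, and let $v\in\mathbb{R}^d$. Define $M_{1,1}=\mathbb{E}[yx]$, $M_{2,2}=\mathbb{E}[y^2xx^T]$, $M_{3,1}=\mathbb{E}[y^3x]$ and $M_{3,3}=\mathbb{E}[y^3\langle x,v\rangle xx^T]$. Then $$M_{1,1}=\sum_{i=1}^k\alpha_i\mu_i,$$ $$M_{2,2}=2\sum_{i=1}^k\alpha_i\mu_i\mu_i^T+\Bigl(\sigma^2+\sum_{i=1}^k\alpha_i\|\mu_i\|^2\Bigr)I,$$ $$M_{3,1}=3\sum_{i=1}^k\alpha_i(\sigma^2+\|\mu_i\|^2)\mu_i,$$ $$M_{3,3}=6\sum_{i=1}^k\alpha_i\langle\mu_i,v\rangle\mu_i\mu_i^T+\bigl(M_{3,1}v^T+vM_{3,1}^T+\langle M_{3,1},v\rangle I\bigr).$$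
   Context: Mixed linear regression model: $\alpha_i\ge0$, $\sum_i\alpha_i=1$, $\mu_i\in\mathbb{R}^d$. An index $i\in\{1,\dots,k\}$ is chosen with probability $\alpha_i$; independently $x\sim\mathcal{N}(0,I)$ in $\mathbb{R}^d$ and $\xi\sim\mathcal{N}(0,\sigma^2)$ in $\mathbb{R}$ are drawn (independent of each other and of $i$), and $y=\langle x,\mu_i\rangle+\xi$. $I$ is the $d\times d$ identity. *)

theory Defs
  imports "HOL-Probability.Probability"
begin

definition std_gaussian :: "(real ^ 'd) measure" where
  "std_gaussian = density lborel
     (\<lambda>z. ennreal ((2 * pi) powr (- real CARD('d) / 2) * exp (- (norm z)\<^sup>2 / 2)))"

text \<open>
  The law \<open>N(0, \<sigma>\<^sup>2)\<close> on the real line. For \<open>\<sigma> = 0\<close> it is the point mass at 0, which has no density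
  (\<open>normal_density 0 0\<close> is the zero function), hence the case distinction.
\<close>

definition noise_law :: "real \<Rightarrow> real measure" where
  "noise_law \<sigma> = (if \<sigma> = 0 then return borel 0 else density lborel (\<lambda>t. ennreal (normal_density 0 \<sigma> t)))"

text \<open>
  The joint law of \<open>(x, y)\<close>. The product measure makes the index \<open>i\<close>, the covariate \<open>x\<close> and the
  noise \<open>\<xi>\<close> mutually independent; \<open>point_measure\<close> gives index \<open>i\<close> the mass \<open>\<alpha> i\<close>. The values of
  \<open>\<alpha>\<close> and \<open>\<mu>\<close> outside \<open>{1..k}\<close> are irrelevant.
\<close>

definition mlr_law ::
    "nat \<Rightarrow> (nat \<Rightarrow> real) \<Rightarrow> (nat \<Rightarrow> real ^ 'd) \<Rightarrow> real \<Rightarrow> ((real ^ 'd) \<times> real) measure" where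
  "mlr_law k \<alpha> \<mu> \<sigma> =
     distr (point_measure {1..k} (\<lambda>i. ennreal (\<alpha> i)) \<Otimes>\<^sub>M std_gaussian \<Otimes>\<^sub>M noise_law \<sigma>)
       (borel \<Otimes>\<^sub>M borel) (\<lambda>(i, x, \<xi>). (x, x \<bullet> \<mu> i + \<xi>))"

definition outer :: "real ^ 'd \<Rightarrow> real ^ 'd \<Rightarrow> real ^ 'd ^ 'd" where
  "outer u w = (columnvector u :: real ^ 1 ^ 'd) ** rowvector w"

end

theory Submission
  imports Defs
begin

text \<open>
  The moments of a single component reduce to \<open>E[\<langle>x,a\<^sub>1\<rangle> \<dots> \<langle>x,a\<^sub>n\<rangle>]\<close> for standard Gaussian \<open>x\<close>, after
  expanding \<open>y\<^sup>p = (\<langle>x,\<mu>\<rangle> + \<xi>)\<^sup>p\<close> binomially. These satisfy the Wick recursion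
  \<open>E[\<langle>x,a\<rangle> \<Prod>\<^sub>i \<langle>x,a\<^sub>i\<rangle>] = \<Sum>\<^sub>i \<langle>a,a\<^sub>i\<rangle> E[\<Prod>\<^sub>j\<^sub>\<noteq>\<^sub>i \<langle>x,a\<^sub>j\<rangle>]\<close>: both sides are multilinear in the vectors, so it
  suffices to check it on basis vectors, where independence of the coordinates turns it into the
  one-dimensional recursion \<open>m\<^sub>n\<^sub>+\<^sub>1 = n m\<^sub>n\<^sub>-\<^sub>1\<close>.
\<close>

section \<open>Coordinate factorisation of the standard Gaussian\<close>

text \<open>The density splits into one-dimensional normal densities, and Lebesgue measure is the
  image of the product measure indexed by \<open>Basis\<close> under
  \<open>\<lambda>g. \<Sum>b\<in>Basis. g b *\<^sub>R b\<close>. Fubini on that product then amounts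
  to independence of the coordinates.\<close>

lemma integral_std_gaussian_prod:
  fixes f :: "real ^ 'd \<Rightarrow> real \<Rightarrow> real"
  assumes f: "\<And>b. b \<in> Basis \<Longrightarrow> integrable lborel (\<lambda>t. std_normal_density t * f b t)"
    and [measurable]: "\<And>b. b \<in> Basis \<Longrightarrow> f b \<in> borel_measurable borel"
  shows "integrable std_gaussian (\<lambda>x. \<Prod>b\<in>Basis. f b (x \<bullet> b))"
    and "(\<integral>x. (\<Prod>b\<in>Basis. f b (x \<bullet> b)) \<partial>std_gaussian)
       = (\<Prod>b\<in>Basis. \<integral>t. std_normal_density t * f b t \<partial>lborel)"
proof -
  define c where "c x = (2 * pi) powr (- real CARD('d) / 2) * exp (- (norm x)\<^sup>2 / 2)"
    for x :: "real ^ 'd"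
  interpret L: product_sigma_finite "\<lambda>_ :: real ^ 'd. lborel :: real measure"
    by standard
  have [measurable]: "c \<in> borel_measurable borel"
    unfolding c_def by measurable
  have c_eq: "c x = (\<Prod>b\<in>Basis. std_normal_density (x \<bullet> b))" for x
  proof -
    have "(2 * pi) powr (- real CARD('d) / 2) = (1 / sqrt (2 * pi)) ^ CARD('d)"
      by (simp add: powr_half_sqrt[symmetric] powr_minus_divide powr_powr power_one_over
          powr_realpow[symmetric] del: powr_half_sqrt powr_half_sqrt_powr)
    moreover have "(norm x)\<^sup>2 = (\<Sum>b\<in>Basis. (x \<bullet> b)\<^sup>2)"
      unfolding power2_norm_eq_inner by (subst euclidean_inner) (simp add: power2_eq_square)
    ultimately show ?thesis
      by (simp add: c_def std_normal_density_def prod.distrib exp_sum[symmetric]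
          prod_dividef power_divide sum_negf[symmetric] sum_divide_distrib)
  qed
  define F where "F g = (\<Prod>b\<in>Basis. std_normal_density (g b) * f b (g b))" for g
  have F_eq: "c (\<Sum>b\<in>Basis. g b *\<^sub>R b) * (\<Prod>b\<in>Basis. f b (g b)) = F g" for g
    unfolding c_eq F_def by (simp add: prod.distrib[symmetric])
  have int: "integrable (\<Pi>\<^sub>M b\<in>Basis. lborel) F"
    unfolding F_def by (rule L.product_integrable_prod) (auto intro: f)
  have val: "(\<integral>g. F g \<partial>(\<Pi>\<^sub>M b\<in>Basis. lborel)) = (\<Prod>b\<in>Basis. \<integral>t. std_normal_density t * f b t \<partial>lborel)"
    unfolding F_def by (rule L.product_integral_prod) (auto intro: f)
  have int': "integrable lborel (\<lambda>x. c x * (\<Prod>b\<in>Basis. f b (x \<bullet> b)))"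
    by (subst lborel_eq, subst integrable_distr_eq) (simp_all add: F_eq int)
  have val': "(\<integral>x. c x * (\<Prod>b\<in>Basis. f b (x \<bullet> b)) \<partial>lborel) = (\<integral>g. F g \<partial>(\<Pi>\<^sub>M b\<in>Basis. lborel))"
    by (subst lborel_eq, subst integral_distr) (simp_all add: F_eq)
  have dens: "std_gaussian = density lborel (\<lambda>x. ennreal (c x))"
    by (simp add: std_gaussian_def c_def)
  have c0: "c x \<ge> 0" for x by (simp add: c_def)
  show "integrable std_gaussian (\<lambda>x. \<Prod>b\<in>Basis. f b (x \<bullet> b))"
    unfolding dens by (subst integrable_density) (use int' in \<open>simp_all add: c0\<close>)
  show "(\<integral>x. (\<Prod>b\<in>Basis. f b (x \<bullet> b)) \<partial>std_gaussian)
       = (\<Prod>b\<in>Basis. \<integral>t. std_normal_density t * f b t \<partial>lborel)"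
    unfolding dens val[symmetric] val'[symmetric]
    by (subst integral_density) (simp_all add: c0)
qed

lemma sets_std_gaussian [measurable_cong, simp]: "sets std_gaussian = sets borel"
  by (simp add: std_gaussian_def)

text \<open>With all factors equal to 1, the total mass is a product of masses of one-dimensional
  normal laws.\<close>

lemma prob_space_std_gaussian: "prob_space (std_gaussian :: (real ^ 'd) measure)"
proof -
  have "integrable std_gaussian (\<lambda>x :: real ^ 'd. 1 :: real)"
       "(\<integral>x. 1 \<partial>(std_gaussian :: (real ^ 'd) measure)) = (1 :: real)"
    using integral_std_gaussian_prod[of "\<lambda>_ _. 1"] by simp_all
  then have "(\<integral>\<^sup>+x. ennreal 1 \<partial>(std_gaussian :: (real ^ 'd) measure)) = 1"
    by (subst nn_integral_eq_integral) simp_all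
  then show ?thesis
    by (intro prob_spaceI) simp
qed

section \<open>Moments of the one-dimensional standard normal law\<close>

definition std_normal_moment :: "nat \<Rightarrow> real" where
  "std_normal_moment n = (\<integral>t. std_normal_density t * t ^ n \<partial>lborel)"

lemma std_normal_moment_0 [simp]: "std_normal_moment 0 = 1"
  using integral_std_normal_moment_even[of 0] by (simp add: std_normal_moment_def)

lemma std_normal_moment_odd: "odd n \<Longrightarrow> std_normal_moment n = 0"
  using integral_std_normal_moment_odd by (auto simp: std_normal_moment_def elim!: oddE)

text \<open>For even \<open>n\<close> both sides vanish: the moments are odd ones, or
  \<open>n = 0\<close> and the factor \<open>real n\<close> absorbs the truncated
  \<open>n - 1\<close>. For \<open>n = 2 * k + 1\<close> the closed form (2k)!/(2^k k!) of the even
  moments gives the ratio 2k+1.\<close>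

lemma std_normal_moment_Suc: "std_normal_moment (Suc n) = real n * std_normal_moment (n - 1)"
proof (cases "even n")
  case True
  then show ?thesis
    by (cases n) (simp_all add: std_normal_moment_odd)
next
  case False
  then obtain k where k: "n = 2 * k + 1" by (elim oddE)
  have 1: "std_normal_moment (Suc n) = fact (2 * Suc k) / (2 ^ Suc k * fact (Suc k))"
    unfolding std_normal_moment_def k integral_std_normal_moment_even[symmetric]
    by simp
  have 2: "std_normal_moment (n - 1) = fact (2 * k) / (2 ^ k * fact k)"
    unfolding std_normal_moment_def k integral_std_normal_moment_even[symmetric]
    by simp
  have num: "fact (2 * Suc k) = (2 * real k + 2) * ((2 * real k + 1) * fact (2 * k))"
    by (simp add: algebra_simps)
  have den: "(2::real) ^ Suc k * fact (Suc k) = (2 * real k + 2) * (2 ^ k * fact k)"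
    by (simp add: algebra_simps)
  have "2 * real k + 2 \<noteq> 0" by linarith
  then show ?thesis
    unfolding 1 2 num den by (subst mult_divide_mult_cancel_left) (simp_all add: k)
qed

section \<open>Gaussian moments of products of linear forms\<close>

text \<open>Lists keep repeated vectors apart and let multilinearity be expressed as replacing the
  vector at one position.\<close>

definition dot_prod :: "('a::real_inner) list \<Rightarrow> 'a \<Rightarrow> real" where
  "dot_prod as x = (\<Prod>a\<leftarrow>as. x \<bullet> a)"

lemma dot_prod_Nil [simp]: "dot_prod [] x = 1"
  and dot_prod_Cons [simp]: "dot_prod (a # as) x = (x \<bullet> a) * dot_prod as x"
  and dot_prod_append [simp]: "dot_prod (as @ bs) x = dot_prod as x * dot_prod bs x"
  and dot_prod_replicate [simp]: "dot_prod (replicate n a) x = (x \<bullet> a) ^ n"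
  by (simp_all add: dot_prod_def)

lemma measurable_dot_prod [measurable]:
  "dot_prod as \<in> borel_measurable (borel :: 'a::euclidean_space measure)"
  by (induction as) (simp_all add: dot_prod_def)

text \<open>Grouping equal factors yields one power per coordinate, the form to which independence
  of the coordinates applies.\<close>

lemma dot_prod_Basis:
  assumes "set bs \<subseteq> Basis"
  shows "dot_prod bs x = (\<Prod>b\<in>Basis. (x \<bullet> b) ^ count_list bs b)"
  using assms
proof (induction bs)
  case (Cons a bs)
  have "(\<Prod>b\<in>Basis. (x \<bullet> b) ^ count_list (a # bs) b)
      = (\<Prod>b\<in>Basis. (if b = a then x \<bullet> b else 1) * (x \<bullet> b) ^ count_list bs b)"
    by (intro prod.cong) auto
  then show ?case
    using Cons by (simp add: prod.distrib)
qed simp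

definition gauss_moment :: "(real ^ 'd) list \<Rightarrow> real" where
  "gauss_moment as = (\<integral>x. dot_prod as x \<partial>std_gaussian)"

lemma gauss_moment_Basis:
  fixes bs :: "(real ^ 'd) list"
  assumes "set bs \<subseteq> Basis"
  shows "integrable std_gaussian (dot_prod bs)"
    and "gauss_moment bs = (\<Prod>b\<in>Basis. std_normal_moment (count_list bs b))"
  using integral_std_gaussian_prod[of "\<lambda>b t. t ^ count_list bs b"]
  by (simp_all add: integrable_std_normal_moment dot_prod_Basis[OF assms, abs_def]
      gauss_moment_def std_normal_moment_def)

lemma dot_prod_expand:
  fixes a :: "'a::euclidean_space"
  shows "dot_prod (as @ a # cs) x = (\<Sum>b\<in>Basis. (a \<bullet> b) * dot_prod (as @ b # cs) x)"
proof -
  have "x \<bullet> a = (\<Sum>b\<in>Basis. (a \<bullet> b) * (x \<bullet> b))"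
    by (subst euclidean_inner) (simp add: mult.commute)
  then show ?thesis
    by (simp add: sum_distrib_left sum_distrib_right mult_ac)
qed

text \<open>The induction behind every multilinearity argument: the second premise is met by any
  property that survives linear combinations in a single slot.\<close>

lemma Basis_list_induct:
  fixes as :: "'a::euclidean_space list"
  assumes "\<And>bs. set bs \<subseteq> Basis \<Longrightarrow> P bs"
    and "\<And>as a cs. (\<And>b. b \<in> Basis \<Longrightarrow> P (as @ b # cs)) \<Longrightarrow> P (as @ a # cs)"
  shows "P as"
proof -
  \<comment> \<open>The prefix \<open>bs\<close> holds the slots already specialised to basis
    vectors, \<open>as\<close> those still arbitrary.\<close>
  have "set bs \<subseteq> Basis \<Longrightarrow> P (bs @ as)" for bs
  proof (induction as arbitrary: bs)
    case (Cons a as)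
    have "P (bs @ b # as)" if "b \<in> Basis" for b
      using Cons.IH[of "bs @ [b]"] Cons.prems that by simp
    then show ?case by (rule assms(2))
  qed (simp add: assms(1))
  from this[of "[]"] show ?thesis by simp
qed

lemma integrable_dot_prod:
  "integrable std_gaussian (dot_prod (as :: (real ^ 'd) list))"
proof (induction as rule: Basis_list_induct)
  case (1 bs)
  then show ?case by (rule gauss_moment_Basis)
next
  case (2 as a cs)
  then have "\<And>b. b \<in> Basis \<Longrightarrow> integrable std_gaussian (\<lambda>x. dot_prod (as @ b # cs) x)" .
  then have "integrable std_gaussian (\<lambda>x. \<Sum>b\<in>Basis. (a \<bullet> b) * dot_prod (as @ b # cs) x)"
    by (intro Bochner_Integration.integrable_sum integrable_mult_right)
  then show ?case
    by (simp only: dot_prod_expand[of as a cs, abs_def])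
qed

lemma gauss_moment_expand:
  "gauss_moment (as @ a # cs) = (\<Sum>b\<in>Basis. (a \<bullet> b) * gauss_moment (as @ b # cs))"
  unfolding gauss_moment_def dot_prod_expand[of as a cs]
  by (simp add: integral_sum integrable_dot_prod del: dot_prod_Cons dot_prod_append)

section \<open>The Wick recursion\<close>

text \<open>
  The right-hand side of the Wick recursion for \<open>as @ bs\<close>, restricted to pairings of \<open>a\<close> with members
  of \<open>bs\<close>; \<open>as\<close> accumulates the vectors already passed over.
\<close>

primrec wick_sum :: "real ^ 'd \<Rightarrow> (real ^ 'd) list \<Rightarrow> (real ^ 'd) list \<Rightarrow> real" where
  "wick_sum a as [] = 0"
| "wick_sum a as (b # bs) = (a \<bullet> b) * gauss_moment (as @ bs) + wick_sum a (as @ [b]) bs"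

text \<open>By orthonormality only the occurrences of \<open>a\<close> in \<open>bs\<close>
  contribute, and each contributes the same moment with one \<open>a\<close> removed. The list
  \<open>as @ bs\<close> is preserved by the recursion, so the counts stay fixed. If
  \<open>a\<close> does not occur in \<open>bs\<close>, the leading factor is 0 and the truncated
  \<open>- 1\<close> is harmless.\<close>

lemma wick_sum_Basis:
  assumes "a \<in> Basis" "set as \<subseteq> Basis" "set bs \<subseteq> Basis"
  shows "wick_sum a as bs = real (count_list bs a) * (std_normal_moment (count_list (as @ bs) a - 1)
    * (\<Prod>b\<in>Basis - {a}. std_normal_moment (count_list (as @ bs) b)))"
  using assms
proof (induction bs arbitrary: as)
  case (Cons c bs)
  have IH: "wick_sum a (as @ [c]) bs
    = real (count_list bs a) * (std_normal_moment (count_list (as @ c # bs) a - 1)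
      * (\<Prod>b\<in>Basis - {a}. std_normal_moment (count_list (as @ c # bs) b)))"
    using Cons.IH[of "as @ [c]"] Cons.prems by simp
  show ?case
  proof (cases "c = a")
    case True
    have "gauss_moment (as @ bs) = std_normal_moment (count_list (as @ bs) a)
        * (\<Prod>b\<in>Basis - {a}. std_normal_moment (count_list (as @ bs) b))"
      using Cons.prems by (subst gauss_moment_Basis) (auto simp: prod.remove[of Basis a])
    \<comment> \<open>Reinserting \<open>c = a\<close> changes only the count of \<open>a\<close>,
      which this product leaves out.\<close>
    also have "(\<Prod>b\<in>Basis - {a}. std_normal_moment (count_list (as @ bs) b))
        = (\<Prod>b\<in>Basis - {a}. std_normal_moment (count_list (as @ c # bs) b))"
      using True by (intro prod.cong) auto
    finally show ?thesis
      using True Cons.prems IH by (simp add: inner_same_Basis algebra_simps)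
  next
    case False
    then show ?thesis
      using Cons.prems by (simp add: IH inner_not_same_Basis)
  qed
qed simp

text \<open>This and the next two lemmas give linearity in the paired vector, in a slot already
  passed over, and in a slot still to come.\<close>

lemma wick_sum_expand1: "wick_sum a as bs = (\<Sum>b\<in>Basis. (a \<bullet> b) * wick_sum b as bs)"
proof (induction bs arbitrary: as)
  case (Cons c bs)
  have "a \<bullet> c = (\<Sum>b\<in>Basis. (a \<bullet> b) * (b \<bullet> c))"
    by (subst euclidean_inner) (simp add: inner_commute)
  then show ?case
    by (simp add: Cons[of "as @ [c]"] sum_distrib_left sum_distrib_right sum.distrib algebra_simps)
qed simp

lemma wick_sum_expand2:
  "wick_sum x (as @ a # cs) bs = (\<Sum>b\<in>Basis. (a \<bullet> b) * wick_sum x (as @ b # cs) bs)"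
proof (induction bs arbitrary: cs)
  case (Cons c bs)
  show ?case
    using Cons[of "cs @ [c]"] gauss_moment_expand[of as a "cs @ bs"]
    by (simp add: sum_distrib_left sum.distrib algebra_simps)
qed simp

text \<open>When the recursion reaches \<open>a\<close>, one term pairs it with \<open>x\<close> and
  the rest moves it into the accumulator, where \<open>wick_sum_expand2\<close> takes over.\<close>

lemma wick_sum_expand3:
  "wick_sum x as (bs @ a # cs) = (\<Sum>b\<in>Basis. (a \<bullet> b) * wick_sum x as (bs @ b # cs))"
proof (induction bs arbitrary: as)
  case Nil
  have "x \<bullet> a = (\<Sum>b\<in>Basis. (a \<bullet> b) * (x \<bullet> b))"
    by (subst euclidean_inner) (simp add: mult.commute)
  then show ?case
    using wick_sum_expand2[of x as a "[]" cs]
    by (simp add: sum_distrib_left sum_distrib_right sum.distrib algebra_simps)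
next
  case (Cons c bs)
  show ?case
    using Cons[of "as @ [c]"] gauss_moment_expand[of "as @ bs" a cs]
    by (simp add: sum_distrib_left sum.distrib algebra_simps)
qed

text \<open>As a rewrite rule this evaluates the moment of any explicit list, ending in
  \<open>gauss_moment []\<close>.\<close>

lemma gauss_moment_Cons: "gauss_moment (a # as) = wick_sum a [] as"
proof -
  \<comment> \<open>Phrased with \<open>hd\<close> and \<open>tl\<close> so that the induction can
    run over all slots, including the first.\<close>
  have "L \<noteq> [] \<Longrightarrow> gauss_moment L = wick_sum (hd L) [] (tl L)" for L :: "(real ^ 'd) list"
  proof (induction L rule: Basis_list_induct)
    case (1 L)
    then obtain a bs where L: "L = a # bs" "a \<in> Basis" "set bs \<subseteq> Basis"
      by (cases L) auto
    have "gauss_moment L = (\<Prod>b\<in>Basis. std_normal_moment (count_list L b))"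
      using 1 by (simp add: gauss_moment_Basis)
    \<comment> \<open>The head adds one to the count of \<open>a\<close>, so the one-dimensional
      recursion applies to this factor alone.\<close>
    also have "\<dots> = std_normal_moment (Suc (count_list bs a))
        * (\<Prod>b\<in>Basis - {a}. std_normal_moment (count_list L b))"
      using L by (simp add: prod.remove[of Basis a])
    also have "(\<Prod>b\<in>Basis - {a}. std_normal_moment (count_list L b))
        = (\<Prod>b\<in>Basis - {a}. std_normal_moment (count_list bs b))"
      using L by (intro prod.cong) auto
    finally show ?case
      using L wick_sum_Basis[of a "[]" bs] by (simp add: std_normal_moment_Suc)
  next
    case (2 as a cs)
    show ?case
    \<comment> \<open>The slot being expanded is either the head, which is the paired vector, or
      lies in the tail.\<close>
    proof (cases as)
      case Nil
      then show ?thesis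
        using 2 gauss_moment_expand[of "[]" a cs] wick_sum_expand1[of a "[]" cs] by simp
    next
      case (Cons d ds)
      then show ?thesis
        using 2 gauss_moment_expand[of as a cs] wick_sum_expand3[of d "[]" ds a cs] by simp
    qed
  qed
  from this[of "a # as"] show ?thesis by simp
qed

lemma gauss_moment_Nil [simp]: "gauss_moment [] = 1"
  using gauss_moment_Basis(2)[of "[]"] by simp

section \<open>Moments of the noise\<close>

text \<open>The noise is distributed like \<bar>\<sigma>\<bar> times a standard normal variable; the
  absolute value allows negative \<sigma>. For \<sigma> = 0 both sides are \<open>0 ^ n\<close>, and
  otherwise closed forms are compared by parity of \<open>n\<close>.\<close>

lemma noise_law_moment:
  shows "integrable (noise_law \<sigma>) (\<lambda>t. t ^ n)"
    and "(\<integral>t. t ^ n \<partial>noise_law \<sigma>) = \<bar>\<sigma>\<bar> ^ n * std_normal_moment n"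
proof -
  have "has_bochner_integral (noise_law \<sigma>) (\<lambda>t. t ^ n) (\<bar>\<sigma>\<bar> ^ n * std_normal_moment n)"
  proof (cases "\<sigma> = 0")
    case True
    interpret prob_space "return borel (0 :: real)" by (simp add: prob_space_return)
    have "integrable (return borel (0 :: real)) (\<lambda>t. t ^ n)"
      by (rule integrable_const_bound[of _ "0 ^ n"]) (simp_all add: AE_return)
    then show ?thesis
      using True prob_space
      by (cases n) (simp_all add: noise_law_def has_bochner_integral_iff integral_return)
  next
    case False
    then have pos: "0 < \<bar>\<sigma>\<bar>" by simp
    \<comment> \<open>The density depends on \<sigma> only through its square, while the moment
      formulas ask for a positive deviation.\<close>
    have eq: "normal_density 0 \<sigma> = normal_density 0 \<bar>\<sigma>\<bar>"
      by (simp add: normal_density_def fun_eq_iff)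
    have "has_bochner_integral lborel (\<lambda>t. normal_density 0 \<bar>\<sigma>\<bar> t * t ^ n)
        (\<bar>\<sigma>\<bar> ^ n * std_normal_moment n)"
    proof (cases "even n")
      case True
      then obtain k where n: "n = 2 * k" by (elim evenE)
      have "\<bar>\<sigma>\<bar> ^ n * std_normal_moment n = fact (2 * k) / ((2 / \<bar>\<sigma>\<bar>\<^sup>2) ^ k * fact k)"
        unfolding n std_normal_moment_def integral_std_normal_moment_even
        using False by (simp add: power_divide power_mult)
      then show ?thesis
        using normal_moment_even[OF pos, of 0 k] by (simp add: n)
    next
      case False
      then show ?thesis
        using normal_moment_odd[OF pos, of 0] by (auto simp: std_normal_moment_odd elim!: oddE)
    qed
    then show ?thesis
      using False unfolding noise_law_def eq
      by (simp add: has_bochner_integral_density normal_density_nonneg)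
  qed
  then show "integrable (noise_law \<sigma>) (\<lambda>t. t ^ n)"
    and "(\<integral>t. t ^ n \<partial>noise_law \<sigma>) = \<bar>\<sigma>\<bar> ^ n * std_normal_moment n"
    by (simp_all add: has_bochner_integral_iff)
qed

lemma sets_noise_law [measurable_cong, simp]: "sets (noise_law \<sigma>) = sets borel"
  by (simp add: noise_law_def)

lemma prob_space_noise_law: "prob_space (noise_law \<sigma>)"
proof (cases "\<sigma> = 0")
  case True
  then show ?thesis by (simp add: noise_law_def prob_space_return)
next
  case False
  have "normal_density 0 \<sigma> = normal_density 0 \<bar>\<sigma>\<bar>"
    by (simp add: normal_density_def fun_eq_iff)
  then show ?thesis
    using False prob_space_normal_density[of "\<bar>\<sigma>\<bar>" 0] by (simp add: noise_law_def)
qed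

section \<open>Moments of a single regression component\<close>

text \<open>Fubini for separated variables, used to factor expectations over the independent
  covariate and noise.\<close>

lemma (in pair_sigma_finite) integral_pair_mult:
  fixes f :: "'a \<Rightarrow> real" and g :: "'b \<Rightarrow> real"
  assumes f: "integrable M1 f" and g: "integrable M2 g"
  shows "integrable (M1 \<Otimes>\<^sub>M M2) (\<lambda>(x, y). f x * g y)"
    and "(\<integral>(x, y). f x * g y \<partial>(M1 \<Otimes>\<^sub>M M2)) = (\<integral>x. f x \<partial>M1) * (\<integral>y. g y \<partial>M2)"
proof -
  show int: "integrable (M1 \<Otimes>\<^sub>M M2) (\<lambda>(x, y). f x * g y)"
    using f g by (intro Fubini_integrable) (auto simp: abs_mult)
  show "(\<integral>(x, y). f x * g y \<partial>(M1 \<Otimes>\<^sub>M M2)) = (\<integral>x. f x \<partial>M1) * (\<integral>y. g y \<partial>M2)"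
    using integral_fst'[OF int] by simp
qed

text \<open>The expectation of \<open>(x \<bullet> m + t) ^ p * dot_prod as x\<close> in binomially
  expanded form. Listing \<open>m\<close> as \<open>j\<close> further vectors turns the power of
  \<open>x \<bullet> m\<close> into part of a Gaussian moment.\<close>

definition response_moment :: "real \<Rightarrow> real ^ 'd \<Rightarrow> nat \<Rightarrow> (real ^ 'd) list \<Rightarrow> real" where
  "response_moment \<sigma> m p as = (\<Sum>j\<le>p. real (p choose j) *
          (gauss_moment (replicate j m @ as) * (\<bar>\<sigma>\<bar> ^ (p - j) * std_normal_moment (p - j))))"

lemma linear_response_moment:
  fixes m :: "real ^ 'd"
  shows "integrable (std_gaussian \<Otimes>\<^sub>M noise_law \<sigma>) (\<lambda>(x, t). (x \<bullet> m + t) ^ p * dot_prod as x)"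
    and "(\<integral>(x, t). (x \<bullet> m + t) ^ p * dot_prod as x \<partial>(std_gaussian \<Otimes>\<^sub>M noise_law \<sigma>))
      = response_moment \<sigma> m p as"
proof -
  interpret G: prob_space "std_gaussian :: (real ^ 'd) measure" by (rule prob_space_std_gaussian)
  interpret N: prob_space "noise_law \<sigma>" by (rule prob_space_noise_law)
  interpret P: pair_sigma_finite "std_gaussian :: (real ^ 'd) measure" "noise_law \<sigma>" ..
  define T where "T j = (\<lambda>(x, t). dot_prod (replicate j m @ as) x * t ^ (p - j))" for j
  have expand: "(\<lambda>(x, t). (x \<bullet> m + t) ^ p * dot_prod as x) = (\<lambda>z. \<Sum>j\<le>p. real (p choose j) * T j z)"
    by (auto simp: fun_eq_iff T_def binomial_ring sum_distrib_left mult_ac)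
  have int: "integrable (std_gaussian \<Otimes>\<^sub>M noise_law \<sigma>) (T j)" for j
    unfolding T_def by (rule P.integral_pair_mult(1)) (rule integrable_dot_prod noise_law_moment)+
  have val: "(\<integral>z. T j z \<partial>(std_gaussian \<Otimes>\<^sub>M noise_law \<sigma>))
      = gauss_moment (replicate j m @ as) * (\<bar>\<sigma>\<bar> ^ (p - j) * std_normal_moment (p - j))" for j
    unfolding T_def gauss_moment_def noise_law_moment(2)[symmetric]
    by (rule P.integral_pair_mult(2)) (rule integrable_dot_prod noise_law_moment)+
  show "integrable (std_gaussian \<Otimes>\<^sub>M noise_law \<sigma>) (\<lambda>(x, t). (x \<bullet> m + t) ^ p * dot_prod as x)"
    unfolding expand by (intro Bochner_Integration.integrable_sum integrable_mult_right int)
  show "(\<integral>(x, t). (x \<bullet> m + t) ^ p * dot_prod as x \<partial>(std_gaussian \<Otimes>\<^sub>M noise_law \<sigma>))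
      = response_moment \<sigma> m p as"
    unfolding expand by (simp add: integral_sum int val response_moment_def)
qed

lemma response_moment_1_1: "response_moment \<sigma> m 1 [a] = m \<bullet> a"
  by (simp add: response_moment_def gauss_moment_Cons std_normal_moment_Suc)

text \<open>The noise term gives \<sigma>^2 (a \<bullet> b); the three pairings of m, m, a, b give
  the rest. The mixed term has an odd noise moment and vanishes.\<close>

lemma response_moment_2_2:
  "response_moment \<sigma> m 2 [a, b] = 2 * (m \<bullet> a) * (m \<bullet> b) + (\<sigma>\<^sup>2 + m \<bullet> m) * (a \<bullet> b)"
  by (simp add: response_moment_def gauss_moment_Cons std_normal_moment_Suc numeral_eq_Suc
      algebra_simps)

lemma response_moment_3_1: "response_moment \<sigma> m 3 [a] = 3 * (\<sigma>\<^sup>2 + m \<bullet> m) * (m \<bullet> a)"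
  by (simp add: response_moment_def gauss_moment_Cons std_normal_moment_Suc numeral_eq_Suc
      algebra_simps)

text \<open>Of the 15 pairings of m, m, m, v, a, b, six match every m with one of v, a, b, and nine
  contain an (m, m) pair. The latter join the three pairings of m, v, a, b weighted by 3
  \<sigma>^2.\<close>

lemma response_moment_3_3:
  "response_moment \<sigma> m 3 [v, a, b] = 6 * (m \<bullet> v) * (m \<bullet> a) * (m \<bullet> b)
    + 3 * (\<sigma>\<^sup>2 + m \<bullet> m) * ((m \<bullet> a) * (v \<bullet> b) + (v \<bullet> a) * (m \<bullet> b) + (m \<bullet> v) * (a \<bullet> b))"
  by (simp add: response_moment_def gauss_moment_Cons std_normal_moment_Suc numeral_eq_Suc
      algebra_simps)

section \<open>Moments of the mixture\<close>

text \<open>Fubini isolates the index: for fixed \<open>i\<close> the inner integral is a component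
  moment, and integrating over the point measure is a weighted finite sum.\<close>

lemma mlr_law_moment:
  fixes \<mu> :: "nat \<Rightarrow> real ^ 'd"
  assumes \<alpha>: "\<And>i. i \<in> {1..k} \<Longrightarrow> 0 \<le> \<alpha> i"
  shows "integrable (mlr_law k \<alpha> \<mu> \<sigma>) (\<lambda>(x, y). y ^ p * dot_prod as x)"
    and "(\<integral>(x, y). y ^ p * dot_prod as x \<partial>mlr_law k \<alpha> \<mu> \<sigma>)
      = (\<Sum>i=1..k. \<alpha> i * response_moment \<sigma> (\<mu> i) p as)"
proof -
  define A where "A = point_measure {1..k} (\<lambda>i. ennreal (\<alpha> i))"
  define B where "B = (std_gaussian :: (real ^ 'd) measure) \<Otimes>\<^sub>M noise_law \<sigma>"
  interpret G: prob_space "std_gaussian :: (real ^ 'd) measure" by (rule prob_space_std_gaussian)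
  interpret N: prob_space "noise_law \<sigma>" by (rule prob_space_noise_law)
  interpret GN: pair_prob_space "std_gaussian :: (real ^ 'd) measure" "noise_law \<sigma>" ..
  interpret A: finite_measure A
    by (rule finite_measureI) (simp add: A_def space_point_measure emeasure_point_measure_finite)
  interpret B: prob_space B
    unfolding B_def by unfold_locales
  interpret AB: pair_sigma_finite A B ..
  have [measurable_cong]: "sets B = sets (borel \<Otimes>\<^sub>M borel)"
    unfolding B_def by (intro sets_pair_measure_cong) simp_all
  have [measurable]: "\<mu> \<in> borel_measurable A"
    by (simp add: A_def measurable_point_measure_eq1)
  have meas: "(\<lambda>(i, x, t). (x, x \<bullet> \<mu> i + t)) \<in> A \<Otimes>\<^sub>M B \<rightarrow>\<^sub>M borel \<Otimes>\<^sub>M borel"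
    by measurable
  define f where "f = (\<lambda>(i, x, t). (x \<bullet> \<mu> i + t) ^ p * dot_prod as x)"
  have [measurable]: "f \<in> borel_measurable (A \<Otimes>\<^sub>M B)"
    unfolding f_def by measurable
  have law: "mlr_law k \<alpha> \<mu> \<sigma> = distr (A \<Otimes>\<^sub>M B) (borel \<Otimes>\<^sub>M borel) (\<lambda>(i, x, t). (x, x \<bullet> \<mu> i + t))"
    by (simp add: mlr_law_def A_def B_def)
  have int: "integrable B (\<lambda>z. f (i, z))" for i
    using linear_response_moment(1)[where m = "\<mu> i" and p = p and as = as and \<sigma> = \<sigma>]
    by (simp add: f_def B_def)
  have val: "(\<integral>z. f (i, z) \<partial>B) = response_moment \<sigma> (\<mu> i) p as" for i
    using linear_response_moment(2)[where m = "\<mu> i" and p = p and as = as and \<sigma> = \<sigma>]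
    by (simp add: f_def B_def)
  have int_f: "integrable (A \<Otimes>\<^sub>M B) f"
  proof (rule AB.Fubini_integrable)
    \<comment> \<open>Every function is integrable over a finite index set with finite
      weights.\<close>
    show "integrable A (\<lambda>i. \<integral>z. norm (f (i, z)) \<partial>B)"
      unfolding A_def by (rule integrable_point_measure_finite) simp
  qed (simp_all add: int)
  have comp: "(\<lambda>(x, y). y ^ p * dot_prod as x) ((\<lambda>(i, x, t). (x, x \<bullet> \<mu> i + t)) z) = f z" for z
    by (simp add: f_def split: prod.split)
  have [measurable]: "(\<lambda>(x, y). y ^ p * dot_prod as x) \<in> borel_measurable (borel \<Otimes>\<^sub>M borel)"
    by measurable
  show "integrable (mlr_law k \<alpha> \<mu> \<sigma>) (\<lambda>(x, y). y ^ p * dot_prod as x)"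
    unfolding law by (subst integrable_distr_eq[OF meas]) (simp_all only: comp int_f, measurable)
  have "(\<integral>(x, y). y ^ p * dot_prod as x \<partial>mlr_law k \<alpha> \<mu> \<sigma>) = (\<integral>z. f z \<partial>(A \<Otimes>\<^sub>M B))"
    unfolding law by (subst integral_distr[OF meas]) (simp_all only: comp, measurable)
  also have "\<dots> = (\<integral>i. response_moment \<sigma> (\<mu> i) p as \<partial>A)"
    by (subst AB.integral_fst'[OF int_f, symmetric]) (simp add: val)
  also have "\<dots> = (\<Sum>i=1..k. \<alpha> i * response_moment \<sigma> (\<mu> i) p as)"
    unfolding A_def using \<alpha> by (subst lebesgue_integral_point_measure_finite) simp_all
  finally show "(\<integral>(x, y). y ^ p * dot_prod as x \<partial>mlr_law k \<alpha> \<mu> \<sigma>)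
      = (\<Sum>i=1..k. \<alpha> i * response_moment \<sigma> (\<mu> i) p as)" .
qed

section \<open>Entrywise integration and the four identities\<close>

text \<open>A vector is the sum of its coordinates embedded along the axes, so integrability passes
  from coordinates to the vector. Entries may themselves be vectors, so two applications handle
  matrices.\<close>

lemma integral_vec_nth:
  fixes f :: "'a \<Rightarrow> 'b::euclidean_space ^ 'n"
  assumes "\<And>i. integrable M (\<lambda>x. f x $ i)"
  shows "integrable M f" and "(\<integral>x. f x \<partial>M) $ i = (\<integral>x. f x $ i \<partial>M)"
proof -
  have "linear (axis i :: 'b \<Rightarrow> 'b ^ 'n)" for i
    by (rule linearI) (simp_all add: vec_eq_iff axis_def)
  then have "integrable M (\<lambda>x. \<Sum>i\<in>UNIV. axis i (f x $ i))"
    using assms by (intro Bochner_Integration.integrable_sum)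
      (auto intro: integrable_bounded_linear simp: linear_conv_bounded_linear)
  moreover have "(\<lambda>x. \<Sum>i\<in>UNIV. axis i (f x $ i)) = f"
    by (simp add: fun_eq_iff vec_eq_iff axis_def)
  ultimately show int: "integrable M f" by simp
  show "(\<integral>x. f x \<partial>M) $ i = (\<integral>x. f x $ i \<partial>M)"
    by (rule integral_bounded_linear[OF bounded_linear_vec_nth int, symmetric])
qed

lemma outer_nth [simp]: "outer u w $ i $ j = u $ i * w $ j"
  by (simp add: outer_def matrix_matrix_mult_def columnvector_def rowvector_def)

theorem lemma11:
  fixes M :: "'a measure"
    and X :: "'a \<Rightarrow> real ^ 'd" and Y :: "'a \<Rightarrow> real"
    and k :: nat and \<alpha> :: "nat \<Rightarrow> real" and \<mu> :: "nat \<Rightarrow> real ^ 'd" and \<sigma> :: real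
    and v :: "real ^ 'd"
    and M11 M31 :: "real ^ 'd" and M22 M33 :: "real ^ 'd ^ 'd"
  assumes "prob_space M"
    and "X \<in> borel_measurable M" and "Y \<in> borel_measurable M"
    and "\<And>i. i \<in> {1..k} \<Longrightarrow> 0 \<le> \<alpha> i" and "(\<Sum>i=1..k. \<alpha> i) = 1"
    and "distr M (borel \<Otimes>\<^sub>M borel) (\<lambda>\<omega>. (X \<omega>, Y \<omega>)) = mlr_law k \<alpha> \<mu> \<sigma>"
    and "M11 = (\<integral>\<omega>. Y \<omega> *\<^sub>R X \<omega> \<partial>M)"
    and "M22 = (\<integral>\<omega>. (Y \<omega>)\<^sup>2 *\<^sub>R outer (X \<omega>) (X \<omega>) \<partial>M)"
    and "M31 = (\<integral>\<omega>. (Y \<omega>) ^ 3 *\<^sub>R X \<omega> \<partial>M)"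
    and "M33 = (\<integral>\<omega>. ((Y \<omega>) ^ 3 * (X \<omega> \<bullet> v)) *\<^sub>R outer (X \<omega>) (X \<omega>) \<partial>M)"
  shows "integrable M (\<lambda>\<omega>. Y \<omega> *\<^sub>R X \<omega>) \<and>
         integrable M (\<lambda>\<omega>. (Y \<omega>)\<^sup>2 *\<^sub>R outer (X \<omega>) (X \<omega>)) \<and>
         integrable M (\<lambda>\<omega>. (Y \<omega>) ^ 3 *\<^sub>R X \<omega>) \<and>
         integrable M (\<lambda>\<omega>. ((Y \<omega>) ^ 3 * (X \<omega> \<bullet> v)) *\<^sub>R outer (X \<omega>) (X \<omega>)) \<and>
         M11 = (\<Sum>i=1..k. \<alpha> i *\<^sub>R \<mu> i) \<and>
         M22 = 2 *\<^sub>R (\<Sum>i=1..k. \<alpha> i *\<^sub>R outer (\<mu> i) (\<mu> i))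
             + (\<sigma>\<^sup>2 + (\<Sum>i=1..k. \<alpha> i * (norm (\<mu> i))\<^sup>2)) *\<^sub>R mat 1 \<and>
         M31 = 3 *\<^sub>R (\<Sum>i=1..k. (\<alpha> i * (\<sigma>\<^sup>2 + (norm (\<mu> i))\<^sup>2)) *\<^sub>R \<mu> i) \<and>
         M33 = 6 *\<^sub>R (\<Sum>i=1..k. (\<alpha> i * (\<mu> i \<bullet> v)) *\<^sub>R outer (\<mu> i) (\<mu> i))
             + (outer M31 v + outer v M31 + (M31 \<bullet> v) *\<^sub>R mat 1)"
proof -
  \<comment> \<open>Writing coordinates as inner products with unit vectors makes every entry of the
    four moments an instance of \<open>Y \<omega> ^ p * dot_prod as (X \<omega>)\<close>.\<close>
  define e where "e = (\<lambda>i :: 'd. axis i 1 :: real ^ 'd)"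
  have nth: "x $ i = x \<bullet> e i" for x i
    by (simp add: e_def inner_axis)
  have mat: "(mat 1 :: real ^ 'd ^ 'd) $ i $ j = e i \<bullet> e j" for i j
    by (simp add: e_def mat_def inner_axis_axis)
  have law: "mlr_law k \<alpha> \<mu> \<sigma> = distr M (borel \<Otimes>\<^sub>M borel) (\<lambda>\<omega>. (X \<omega>, Y \<omega>))"
    using assms(6) by simp
  have [measurable]: "X \<in> borel_measurable M" "Y \<in> borel_measurable M" by fact+
  have int: "integrable M (\<lambda>\<omega>. Y \<omega> ^ p * dot_prod as (X \<omega>))" for p as
    using assms(4) mlr_law_moment(1)[where p = p and as = as and k = k and \<alpha> = \<alpha> and \<mu> = \<mu> and \<sigma> = \<sigma>]
    unfolding law by (subst (asm) integrable_distr_eq) simp_all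
  have val: "(\<integral>\<omega>. Y \<omega> ^ p * dot_prod as (X \<omega>) \<partial>M)
      = (\<Sum>i=1..k. \<alpha> i * response_moment \<sigma> (\<mu> i) p as)" for p as
    using assms(4) mlr_law_moment(2)[where p = p and as = as and k = k and \<alpha> = \<alpha> and \<mu> = \<mu> and \<sigma> = \<sigma>]
    unfolding law by (subst (asm) integral_distr) simp_all
  have eq11: "(Y \<omega> *\<^sub>R X \<omega>) $ a = Y \<omega> ^ 1 * dot_prod [e a] (X \<omega>)" for \<omega> a
    by (simp add: nth[symmetric])
  have eq22: "((Y \<omega>)\<^sup>2 *\<^sub>R outer (X \<omega>) (X \<omega>)) $ a $ b = Y \<omega> ^ 2 * dot_prod [e a, e b] (X \<omega>)"
    for \<omega> a b by (simp add: nth[symmetric])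
  have eq31: "(Y \<omega> ^ 3 *\<^sub>R X \<omega>) $ a = Y \<omega> ^ 3 * dot_prod [e a] (X \<omega>)" for \<omega> a
    by (simp add: nth[symmetric])
  have eq33: "((Y \<omega> ^ 3 * (X \<omega> \<bullet> v)) *\<^sub>R outer (X \<omega>) (X \<omega>)) $ a $ b
      = Y \<omega> ^ 3 * dot_prod [v, e a, e b] (X \<omega>)" for \<omega> a b
    by (simp add: nth[symmetric])
  have int11: "integrable M (\<lambda>\<omega>. Y \<omega> *\<^sub>R X \<omega>)"
    by (intro integral_vec_nth(1)) (unfold eq11, rule int)
  have int22: "integrable M (\<lambda>\<omega>. ((Y \<omega>)\<^sup>2 *\<^sub>R outer (X \<omega>) (X \<omega>)) $ a)" for a
    by (intro integral_vec_nth(1)) (unfold eq22, rule int)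
  have int31: "integrable M (\<lambda>\<omega>. Y \<omega> ^ 3 *\<^sub>R X \<omega>)"
    by (intro integral_vec_nth(1)) (unfold eq31, rule int)
  have int33: "integrable M (\<lambda>\<omega>. ((Y \<omega> ^ 3 * (X \<omega> \<bullet> v)) *\<^sub>R outer (X \<omega>) (X \<omega>)) $ a)" for a
    by (intro integral_vec_nth(1)) (unfold eq33, rule int)
  have val11: "M11 $ a = (\<Sum>i=1..k. \<alpha> i * (\<mu> i \<bullet> e a))" for a
    unfolding assms(7)
    by (subst integral_vec_nth(2)) ((unfold eq11 val response_moment_1_1)?, rule int refl)+
  have val22: "M22 $ a $ b = (\<Sum>i=1..k. \<alpha> i * (2 * (\<mu> i \<bullet> e a) * (\<mu> i \<bullet> e b)
      + (\<sigma>\<^sup>2 + \<mu> i \<bullet> \<mu> i) * (e a \<bullet> e b)))" for a b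
    unfolding assms(8)
    by (subst integral_vec_nth(2), rule int22, subst integral_vec_nth(2))
      ((unfold eq22 val response_moment_2_2)?, rule int refl)+
  have val31: "M31 $ a = (\<Sum>i=1..k. \<alpha> i * (3 * (\<sigma>\<^sup>2 + \<mu> i \<bullet> \<mu> i) * (\<mu> i \<bullet> e a)))" for a
    unfolding assms(9)
    by (subst integral_vec_nth(2)) ((unfold eq31 val response_moment_3_1)?, rule int refl)+
  have val33: "M33 $ a $ b = (\<Sum>i=1..k. \<alpha> i * (6 * (\<mu> i \<bullet> v) * (\<mu> i \<bullet> e a) * (\<mu> i \<bullet> e b)
      + 3 * (\<sigma>\<^sup>2 + \<mu> i \<bullet> \<mu> i) * ((\<mu> i \<bullet> e a) * (v \<bullet> e b) + (v \<bullet> e a) * (\<mu> i \<bullet> e b)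
        + (\<mu> i \<bullet> v) * (e a \<bullet> e b))))" for a b
    unfolding assms(10)
    by (subst integral_vec_nth(2), rule int33, subst integral_vec_nth(2))
      ((unfold eq33 val response_moment_3_3)?, rule int refl)+
  have M11_eq: "M11 = (\<Sum>i=1..k. \<alpha> i *\<^sub>R \<mu> i)"
    by (simp add: vec_eq_iff val11 nth[symmetric])
  have M22_eq: "M22 = 2 *\<^sub>R (\<Sum>i=1..k. \<alpha> i *\<^sub>R outer (\<mu> i) (\<mu> i))
      + (\<sigma>\<^sup>2 + (\<Sum>i=1..k. \<alpha> i * (norm (\<mu> i))\<^sup>2)) *\<^sub>R mat 1"
  proof -
    \<comment> \<open>Since the weights sum to 1, the noise variance can be moved inside the mixture
      sum.\<close>
    have "\<sigma>\<^sup>2 = (\<Sum>i=1..k. \<alpha> i * \<sigma>\<^sup>2)"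
      using assms(5) by (simp add: sum_distrib_right[symmetric])
    then have "\<sigma>\<^sup>2 + (\<Sum>i=1..k. \<alpha> i * (norm (\<mu> i))\<^sup>2) = (\<Sum>i=1..k. \<alpha> i * (\<sigma>\<^sup>2 + \<mu> i \<bullet> \<mu> i))"
      by (simp add: power2_norm_eq_inner sum.distrib distrib_left)
    then show ?thesis
      by (simp add: vec_eq_iff val22 mat nth[symmetric] sum_distrib_left sum_distrib_right
          sum.distrib[symmetric] algebra_simps)
  qed
  have M31_eq: "M31 = 3 *\<^sub>R (\<Sum>i=1..k. (\<alpha> i * (\<sigma>\<^sup>2 + (norm (\<mu> i))\<^sup>2)) *\<^sub>R \<mu> i)"
    by (simp add: vec_eq_iff val31 nth[symmetric] power2_norm_eq_inner sum_distrib_left algebra_simps)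
  have M33_eq: "M33 = 6 *\<^sub>R (\<Sum>i=1..k. (\<alpha> i * (\<mu> i \<bullet> v)) *\<^sub>R outer (\<mu> i) (\<mu> i))
      + (outer M31 v + outer v M31 + (M31 \<bullet> v) *\<^sub>R mat 1)"
  proof -
    \<comment> \<open>The factors 3 \<alpha>_i (\<sigma>^2 + |\<mu>_i|^2) in \<open>val33\<close>
      are the coefficients of \<open>M31\<close>, so its three mixed terms regroup into
      \<open>outer M31 v\<close>, \<open>outer v M31\<close> and the multiple of the
      identity.\<close>
    have "M31 \<bullet> v = (\<Sum>i=1..k. \<alpha> i * (3 * (\<sigma>\<^sup>2 + \<mu> i \<bullet> \<mu> i) * (\<mu> i \<bullet> v)))"
      by (simp add: M31_eq inner_sum_left power2_norm_eq_inner sum_distrib_left algebra_simps)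
    then show ?thesis
      by (simp add: vec_eq_iff val31 val33 mat nth[symmetric] sum_distrib_left sum_distrib_right
          sum.distrib[symmetric] algebra_simps)
  qed
  show ?thesis
    using int11 integral_vec_nth(1)[OF int22] int31 integral_vec_nth(1)[OF int33]
      M11_eq M22_eq M31_eq M33_eq
    by blast
qed

end
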